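(* Let $(W,S)$ be the rank $4$ Coxeter system with $S=\{s_1,s_2,s_3,s_4\}$, $m_{s_1,s_2}=m_{s_1,s_3}=m_{s_2,s_3}=2$, and $m_{s_i,s_4}=m_i$ for $i=1,2,3$. Suppose that $m_1,m_2,m_3<\infty$ and that $\frac{1}{m_i}+\frac{1}{m_j}\leq\frac12$ for each pair $i,j\in\{1,2,3\}$ with $i\neq j$. Let $t_i=2\cos(\pi/m_i)$ and $\alpha_i=\alpha_{s_i}$. Then the root $$\beta=t_1\alpha_1+t_2\alpha_2+t_3\alpha_3+\alpha_4$$ is elementary but not super-elementary.
   Context: $m_{s,t}$ is the order of $st$ in $W$. Root system: $V$ is the real vector space with basis $\{\alpha_s\mid s\in S\}$ and form $\langle\alpha_s,\alpha_t\rangle=-\cos(\pi/m_{s,t})$; $W$ acts by $s\lambda=\lambda-2\langle\lambda,\alpha_s\rangle\alpha_s$; $\Phi=\{w\alpha_s\mid w\in W,s\in S\}$; $\Phi^+$ is the set of roots that are non-negative combinations of the $\alpha_s$ ($\alpha<0$ means $-\alpha\in\Phi^+$). $\Phi(w)=\{\alpha\in\Phi^+\mid w^{-1}\alpha<0\}$. A root $\beta\in\Phi^+$ dominates $\alpha\in\Phi^+$ if for all $w\in W$, $w^{-1}\beta<0$ implies $w^{-1}\alpha<0$; $\beta$ is elementary if it dominates no $\alpha\in\Phi^+\setminus\{\beta\}$. A root $\beta\in\Phi^+$ is super-elementary if there exist $x,y\in W$ with $\Phi(x)\cap\Phi(y)=\{\beta\}$. *)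

theory Defs
  imports "HOL-Analysis.Analysis" "HOL-Algebra.Multiplicative_Group" "HOL-Algebra.Generated_Groups"
begin

text \<open>
  A Coxeter system of finite rank is given by a group \<open>W\<close> and an injective family
  \<open>s :: 'i \<Rightarrow> 'g\<close> over a finite index type; \<open>S\<close> is the range of \<open>s\<close>.
\<close>

section \<open>Coxeter systems\<close>

text \<open>
  \<open>group.ord\<close> is \<open>0\<close> on elements of infinite order, so \<open>cox_m W s i j = 0\<close>
  stands for \<open>m = \<infinity>\<close>.
\<close>
definition cox_m :: "('g, 'b) monoid_scheme \<Rightarrow> ('i \<Rightarrow> 'g) \<Rightarrow> 'i \<Rightarrow> 'i \<Rightarrow> nat" where
  "cox_m W s i j = group.ord W (s i \<otimes>\<^bsub>W\<^esub> s j)"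

definition word_val :: "('g, 'b) monoid_scheme \<Rightarrow> ('i \<Rightarrow> 'g) \<Rightarrow> 'i list \<Rightarrow> 'g" where
  "word_val W s ws = foldr (\<lambda>i g. s i \<otimes>\<^bsub>W\<^esub> g) ws \<one>\<^bsub>W\<^esub>"

text \<open>
  Deletion of one defining relator \<open>(s\<^sub>i s\<^sub>j)\<^bsup>m(i,j)\<^esup>\<close>, \<open>m(i,j) < \<infinity>\<close>, from a word.
\<close>
definition cox_delete :: "('i \<Rightarrow> 'i \<Rightarrow> nat) \<Rightarrow> 'i list \<Rightarrow> 'i list \<Rightarrow> bool" where
  "cox_delete m x y \<longleftrightarrow> (\<exists>u v i j. m i j \<noteq> 0 \<and>
     x = u @ concat (replicate (m i j) [i, j]) @ v \<and> y = u @ v)"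

text \<open>
  The last conjunct says that the relations \<open>(s\<^sub>i s\<^sub>j)\<^bsup>m(i,j)\<^esup> = 1\<close> present \<open>W\<close>.  Words without
  formal inverses suffice: since \<open>m(i,i) = 1\<close>, the relators include \<open>s\<^sub>i s\<^sub>i\<close>, so the monoid
  with this presentation is already the group with this presentation.
\<close>
definition coxeter_system :: "('g, 'b) monoid_scheme \<Rightarrow> ('i::finite \<Rightarrow> 'g) \<Rightarrow> bool" where
  "coxeter_system W s \<longleftrightarrow>
     group W \<and> inj s \<and> range s \<subseteq> carrier W \<and>
     (\<forall>i. group.ord W (s i) = 2) \<and>
     generate W (range s) = carrier W \<and>
     (\<forall>ws. word_val W s ws = \<one>\<^bsub>W\<^esub> \<longrightarrow> equivclp (cox_delete (cox_m W s)) ws [])"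

section \<open>The geometric representation\<close>

definition simple_root :: "'i::finite \<Rightarrow> real ^ 'i" where
  "simple_root i = axis i 1"

text \<open>
  For \<open>m = \<infinity>\<close>, encoded as \<open>0\<close>, the summand has the usual value \<open>-cos 0 = -1\<close>,
  because \<open>pi / 0 = 0\<close>.
\<close>
definition cox_form :: "('g, 'b) monoid_scheme \<Rightarrow> ('i::finite \<Rightarrow> 'g) \<Rightarrow> real ^ 'i \<Rightarrow> real ^ 'i \<Rightarrow> real" where
  "cox_form W s x y = (\<Sum>i\<in>UNIV. \<Sum>j\<in>UNIV. x $ i * y $ j * (- cos (pi / real (cox_m W s i j))))"

definition cox_refl :: "('g, 'b) monoid_scheme \<Rightarrow> ('i::finite \<Rightarrow> 'g) \<Rightarrow> 'i \<Rightarrow> real ^ 'i \<Rightarrow> real ^ 'i" where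
  "cox_refl W s i v = v - (2 * cox_form W s v (simple_root i)) *\<^sub>R simple_root i"

definition word_act :: "('g, 'b) monoid_scheme \<Rightarrow> ('i::finite \<Rightarrow> 'g) \<Rightarrow> 'i list \<Rightarrow> real ^ 'i \<Rightarrow> real ^ 'i" where
  "word_act W s ws v = foldr (cox_refl W s) ws v"

text \<open>
  The choice of a word for \<open>w\<close> is immaterial; see \<open>cox_act_word_val\<close>, \<open>cox_act_gen\<close>
  and \<open>cox_act_mult\<close> below.
\<close>
definition cox_act :: "('g, 'b) monoid_scheme \<Rightarrow> ('i::finite \<Rightarrow> 'g) \<Rightarrow> 'g \<Rightarrow> real ^ 'i \<Rightarrow> real ^ 'i" where
  "cox_act W s w = word_act W s (SOME ws. word_val W s ws = w)"

section \<open>Roots\<close>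

definition roots :: "('g, 'b) monoid_scheme \<Rightarrow> ('i::finite \<Rightarrow> 'g) \<Rightarrow> (real ^ 'i) set" where
  "roots W s = {cox_act W s w (simple_root i) | w i. w \<in> carrier W}"

definition pos_roots :: "('g, 'b) monoid_scheme \<Rightarrow> ('i::finite \<Rightarrow> 'g) \<Rightarrow> (real ^ 'i) set" where
  "pos_roots W s = {\<beta> \<in> roots W s. \<forall>i. 0 \<le> \<beta> $ i}"

definition neg_root :: "('g, 'b) monoid_scheme \<Rightarrow> ('i::finite \<Rightarrow> 'g) \<Rightarrow> real ^ 'i \<Rightarrow> bool" where
  "neg_root W s \<alpha> \<longleftrightarrow> - \<alpha> \<in> pos_roots W s"

definition inversion_set :: "('g, 'b) monoid_scheme \<Rightarrow> ('i::finite \<Rightarrow> 'g) \<Rightarrow> 'g \<Rightarrow> (real ^ 'i) set" where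
  "inversion_set W s w = {\<alpha> \<in> pos_roots W s. neg_root W s (cox_act W s (inv\<^bsub>W\<^esub> w) \<alpha>)}"

definition dominates :: "('g, 'b) monoid_scheme \<Rightarrow> ('i::finite \<Rightarrow> 'g) \<Rightarrow> real ^ 'i \<Rightarrow> real ^ 'i \<Rightarrow> bool" where
  "dominates W s \<beta> \<alpha> \<longleftrightarrow> \<beta> \<in> pos_roots W s \<and> \<alpha> \<in> pos_roots W s \<and>
     (\<forall>w\<in>carrier W. neg_root W s (cox_act W s (inv\<^bsub>W\<^esub> w) \<beta>) \<longrightarrow>
                    neg_root W s (cox_act W s (inv\<^bsub>W\<^esub> w) \<alpha>))"

definition elementary_root :: "('g, 'b) monoid_scheme \<Rightarrow> ('i::finite \<Rightarrow> 'g) \<Rightarrow> real ^ 'i \<Rightarrow> bool" where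
  "elementary_root W s \<beta> \<longleftrightarrow> \<beta> \<in> pos_roots W s \<and>
     \<not> (\<exists>\<alpha> \<in> pos_roots W s - {\<beta>}. dominates W s \<beta> \<alpha>)"

definition super_elementary_root :: "('g, 'b) monoid_scheme \<Rightarrow> ('i::finite \<Rightarrow> 'g) \<Rightarrow> real ^ 'i \<Rightarrow> bool" where
  "super_elementary_root W s \<beta> \<longleftrightarrow> \<beta> \<in> pos_roots W s \<and>
     (\<exists>x\<in>carrier W. \<exists>y\<in>carrier W. inversion_set W s x \<inter> inversion_set W s y = {\<beta>})"

section \<open>Well-definedness of the action\<close>

lemma cox_form_linear_left:
  "cox_form W s (x + y) z = cox_form W s x z + cox_form W s y z"
  "cox_form W s (x - y) z = cox_form W s x z - cox_form W s y z"
  "cox_form W s (c *\<^sub>R x) z = c * cox_form W s x z"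
  by (simp_all add: cox_form_def algebra_simps sum.distrib sum_subtractf sum_distrib_left sum_negf)

lemma cox_form_simple:
  "cox_form W s (simple_root i) (simple_root j) = - cos (pi / real (cox_m W s i j))"
proof -
  have "cox_form W s (simple_root i) (simple_root j) =
      (\<Sum>k\<in>UNIV. \<Sum>l\<in>UNIV. if l = j then (if k = i then - cos (pi / real (cox_m W s k l)) else 0) else 0)"
    unfolding cox_form_def simple_root_def axis_def
    by (intro sum.cong refl) auto
  then show ?thesis by simp
qed

lemma cox_refl_linear: "linear (cox_refl W s i)"
  by (rule linearI) (simp_all add: cox_refl_def cox_form_linear_left algebra_simps)

lemma word_act_append: "word_act W s (u @ v) x = word_act W s u (word_act W s v x)"
  by (simp add: word_act_def)

lemma word_act_replicate:
  "word_act W s (concat (replicate k [i, j])) = ((cox_refl W s i \<circ> cox_refl W s j) ^^ k)"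
  by (induction k) (auto simp: word_act_def fun_eq_iff)

context
  fixes W :: "('g, 'b) monoid_scheme" and s :: "'i::finite \<Rightarrow> 'g"
  assumes cs: "coxeter_system W s"
begin

lemma is_group: "group W" and s_inj: "inj s" and s_closed: "s i \<in> carrier W"
  and s_ord: "group.ord W (s i) = 2"
  using cs unfolding coxeter_system_def by auto

lemma s_sq: "s i \<otimes>\<^bsub>W\<^esub> s i = \<one>\<^bsub>W\<^esub>"
proof -
  interpret group W by (rule is_group)
  have "s i [^]\<^bsub>W\<^esub> (2::nat) = \<one>\<^bsub>W\<^esub>"
    using s_closed s_ord pow_eq_id by simp
  then show ?thesis using s_closed by (simp add: numeral_2_eq_2)
qed

lemma s_inv: "inv\<^bsub>W\<^esub> (s i) = s i"
  using group.inv_equality[OF is_group s_sq s_closed s_closed] .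

lemma cox_m_diag: "cox_m W s i i = 1"
proof -
  interpret group W by (rule is_group)
  show ?thesis by (simp add: cox_m_def s_sq ord_eq_1)
qed

lemma cox_m_neq_1: "i \<noteq> j \<Longrightarrow> cox_m W s i j \<noteq> 1"
proof
  interpret group W by (rule is_group)
  assume "i \<noteq> j" "cox_m W s i j = 1"
  then have "s i \<otimes>\<^bsub>W\<^esub> s j = \<one>\<^bsub>W\<^esub>"
    unfolding cox_m_def using ord_eq_1[of "s i \<otimes>\<^bsub>W\<^esub> s j"] by (simp only: m_closed s_closed)
  then have "s i = inv\<^bsub>W\<^esub> (s j)" using inv_equality[of "s i" "s j"] s_closed by simp
  then show False using \<open>i \<noteq> j\<close> s_inj by (simp add: s_inv inj_eq)
qed

lemma cox_m_sym: "cox_m W s i j = cox_m W s j i"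
proof -
  interpret group W by (rule is_group)
  have "inv\<^bsub>W\<^esub> (s i \<otimes>\<^bsub>W\<^esub> s j) = s j \<otimes>\<^bsub>W\<^esub> s i"
    by (simp add: inv_mult_group s_closed s_inv)
  then show ?thesis unfolding cox_m_def by (metis ord_inv m_closed s_closed)
qed

lemma word_val_closed: "word_val W s ws \<in> carrier W"
proof -
  interpret group W by (rule is_group)
  show ?thesis by (induction ws) (auto simp: word_val_def s_closed)
qed

lemma word_val_append:
  "word_val W s (u @ v) = word_val W s u \<otimes>\<^bsub>W\<^esub> word_val W s v"
proof -
  interpret group W by (rule is_group)
  have val_Cons: "word_val W s (i # w) = s i \<otimes>\<^bsub>W\<^esub> word_val W s w" for i w
    by (simp add: word_val_def)
  show ?thesis
  proof (induction u)
    case Nil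
    then show ?case using word_val_closed[of v] by (simp add: word_val_def)
  next
    case (Cons i u)
    then show ?case by (simp add: val_Cons m_assoc s_closed word_val_closed)
  qed
qed

lemma word_val_rev: "word_val W s (rev ws) = inv\<^bsub>W\<^esub> (word_val W s ws)"
proof -
  interpret group W by (rule is_group)
  show ?thesis
  proof (induction ws)
    case Nil
    then show ?case by (simp add: word_val_def)
  next
    case (Cons i ws)
    have 1: "word_val W s [i] = s i" by (simp add: word_val_def s_closed)
    have "word_val W s (i # ws) = s i \<otimes>\<^bsub>W\<^esub> word_val W s ws" by (simp add: word_val_def)
    then show ?case
      using Cons by (simp add: word_val_append 1 inv_mult_group s_closed word_val_closed s_inv)
  qed
qed

lemma word_val_surj:
  assumes "w \<in> carrier W"
  obtains ws where "word_val W s ws = w"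
proof -
  interpret group W by (rule is_group)
  have "w \<in> generate W (range s)" using assms cs by (simp add: coxeter_system_def)
  then have "\<exists>ws. word_val W s ws = w"
  proof (induction rule: generate.induct)
    case one
    show ?case by (rule exI[of _ "[]"]) (simp add: word_val_def)
  next
    case (incl h)
    then obtain i where "h = s i" by auto
    then show ?case by (intro exI[of _ "[i]"]) (simp add: word_val_def s_closed)
  next
    case (inv h)
    then obtain i where "h = s i" by auto
    then show ?case by (intro exI[of _ "[i]"]) (simp add: word_val_def s_closed s_inv)
  next
    case (eng h1 h2)
    then show ?case by (metis word_val_append)
  qed
  then show ?thesis using that by blast
qed

lemma cox_refl_simple_self: "cox_refl W s i (simple_root i) = - simple_root i"
  by (simp add: cox_refl_def cox_form_simple cox_m_diag scaleR_2)

lemma cox_refl_invol: "cox_refl W s i (cox_refl W s i v) = v"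
  by (simp add: cox_refl_def cox_form_linear_left cox_form_simple cox_m_diag algebra_simps)

lemma cox_refl_braid:
  "((cox_refl W s i \<circ> cox_refl W s j) ^^ cox_m W s i j) v = v"
proof (cases "i = j \<or> cox_m W s i j = 0")
  case True
  then show ?thesis by (auto simp: cox_m_diag cox_refl_invol)
next
  case False
  define m where "m = cox_m W s i j"
  have m: "m \<ge> 2" using False cox_m_neq_1[of i j] by (simp add: m_def)
  define \<theta> where "\<theta> = pi / real m"
  define c where "c = cos \<theta>"
  define S where "S = sin \<theta>"
  have "0 < \<theta>" "\<theta> < pi" using m by (auto simp: \<theta>_def field_simps)
  then have S: "S > 0" by (simp add: S_def sin_gt_zero)
  have cS: "c * c + S * S = 1" by (simp add: c_def S_def flip: power2_eq_square)
  define a where "a = (simple_root i :: real ^ 'i)"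
  define b where "b = (simple_root j :: real ^ 'i)"
  define B where "B = cox_form W s"
  have B: "B a a = 1" "B b b = 1" "B a b = -c" "B b a = -c"
    by (simp_all add: B_def a_def b_def cox_form_simple cox_m_diag c_def \<theta>_def m_def cox_m_sym[of j i])
  define f where "f = cox_refl W s i \<circ> cox_refl W s j"
  have lin: "linear f" unfolding f_def by (intro linear_compose cox_refl_linear)
  have f: "f v = v - (2 * B v b) *\<^sub>R b - (2 * (B v a + 2 * c * B v b)) *\<^sub>R a" for v
  proof -
    have "f v = (v - (2 * B v b) *\<^sub>R b) - (2 * B (v - (2 * B v b) *\<^sub>R b) a) *\<^sub>R a"
      by (simp add: f_def cox_refl_def B_def a_def b_def)
    also have "B (v - (2 * B v b) *\<^sub>R b) a = B v a + 2 * c * B v b"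
      using B(4) by (simp add: B_def cox_form_linear_left)
    finally show ?thesis .
  qed
  have fa: "f a = (4 * c * c - 1) *\<^sub>R a + (2 * c) *\<^sub>R b"
    by (simp add: f B algebra_simps flip: scaleR_add_left scaleR_diff_left)
  have fb: "f b = - (2 * c) *\<^sub>R a - b"
    by (simp add: f B algebra_simps scaleR_2)
  have step: "f (x *\<^sub>R a + y *\<^sub>R b)
      = (x * (4 * c * c - 1) - y * (2 * c)) *\<^sub>R a + (x * (2 * c) - y) *\<^sub>R b" for x y
  proof -
    have "f (x *\<^sub>R a + y *\<^sub>R b) = x *\<^sub>R f a + y *\<^sub>R f b"
      using lin by (simp add: linear_add linear_scale)
    then show ?thesis by (simp add: fa fb algebra_simps)
  qed
  have rec: "sin (t + 2 * \<theta>) = 2 * c * sin (t + \<theta>) - sin t" for t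
  proof -
    have "sin (t + 2 * \<theta>) = sin ((t + \<theta>) + \<theta>)" "sin t = sin ((t + \<theta>) - \<theta>)"
      by (simp_all add: algebra_simps)
    then show ?thesis by (simp only: sin_add[of "t + \<theta>" \<theta>] sin_diff[of "t + \<theta>" \<theta>] c_def) simp
  qed
  have general: "(f ^^ k) (x *\<^sub>R a + y *\<^sub>R b) =
     ((x * sin (2 * k * \<theta> + \<theta>) - y * sin (2 * k * \<theta>)) / S) *\<^sub>R a
     + ((x * sin (2 * k * \<theta>) - y * sin (2 * k * \<theta> - \<theta>)) / S) *\<^sub>R b" for k :: nat and x y
  proof (induction k)
    case 0
    then show ?case using S by (simp add: S_def)
  next
    case (Suc k)
    define p where "p = sin (2 * k * \<theta> - \<theta>)"
    define q where "q = sin (2 * k * \<theta>)"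
    define r where "r = sin (2 * k * \<theta> + \<theta>)"
    have r: "r = 2 * c * q - p"
      using rec[of "2 * k * \<theta> - \<theta>"] by (simp add: p_def q_def r_def algebra_simps)
    have q': "sin (2 * Suc k * \<theta>) = 2 * c * r - q"
      using rec[of "2 * k * \<theta>"] by (simp add: q_def r_def algebra_simps)
    have r': "sin (2 * Suc k * \<theta> + \<theta>) = 2 * c * (2 * c * r - q) - r"
    proof -
      have "sin (2 * Suc k * \<theta> + \<theta>) = 2 * c * sin (2 * Suc k * \<theta>) - r"
        using rec[of "2 * k * \<theta> + \<theta>"] by (simp add: r_def algebra_simps)
      then show ?thesis by (simp only: q')
    qed
    have s': "sin (2 * Suc k * \<theta> - \<theta>) = r"
      by (simp add: r_def algebra_simps)
    have IH: "(f ^^ k) (x *\<^sub>R a + y *\<^sub>R b) =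
        ((x * r - y * q) / S) *\<^sub>R a + ((x * q - y * p) / S) *\<^sub>R b"
      using Suc by (simp add: p_def q_def r_def)
    have 1: "(x * r - y * q) / S * (4 * c * c - 1) - (x * q - y * p) / S * (2 * c)
        = (x * (2 * c * (2 * c * r - q) - r) - y * (2 * c * r - q)) / S"
      using S by (simp add: r divide_simps) (simp add: algebra_simps)
    have 2: "(x * r - y * q) / S * (2 * c) - (x * q - y * p) / S
        = (x * (2 * c * r - q) - y * r) / S"
      using S by (simp add: r divide_simps) (simp add: algebra_simps)
    show ?case by (simp only: funpow.simps o_apply IH step 1 2 q' r' s')
  qed
  have plane: "(f ^^ m) (x *\<^sub>R a + y *\<^sub>R b) = x *\<^sub>R a + y *\<^sub>R b" for x y
  proof -
    have e: "real (2 * m) * \<theta> = 2 * pi" using m by (simp add: \<theta>_def)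
    have "sin (2 * pi + \<theta>) = S" "sin (2 * pi - \<theta>) = - S"
      by (simp_all add: S_def sin_add sin_diff)
    then show ?thesis using S by (simp only: general e) simp
  qed
  define x where "x = (B v a + c * B v b) / (S * S)"
  define y where "y = (B v b + c * B v a) / (S * S)"
  define u where "u = v - (x *\<^sub>R a + y *\<^sub>R b)"
  have SS: "S * S = 1 - c * c" "1 - c * c \<noteq> 0" using S cS by (auto simp: algebra_simps)
  have Blin: "B u z = B v z - (x * B a z + y * B b z)" for z
    by (simp add: u_def B_def cox_form_linear_left)
  have "x - y * c = B v a" "y - x * c = B v b"
    using SS(2) by (simp_all add: x_def y_def SS(1) divide_simps) (simp_all add: algebra_simps)
  then have "B u a = 0" "B u b = 0" by (simp_all add: Blin B algebra_simps)
  then have fu: "f u = u" by (simp add: f)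
  have "(f ^^ k) u = u" for k by (induction k) (simp_all add: fu)
  moreover have "linear (f ^^ k)" for k
    by (induction k) (auto simp: linear_id[unfolded id_def] id_def lin intro: linear_compose[unfolded o_def])
  ultimately have "(f ^^ m) (u + (x *\<^sub>R a + y *\<^sub>R b)) = u + (x *\<^sub>R a + y *\<^sub>R b)"
    by (simp add: linear_add plane)
  then show ?thesis by (simp add: u_def m_def f_def)
qed

lemma word_act_cong:
  "equivclp (cox_delete (cox_m W s)) x y \<Longrightarrow> word_act W s x = word_act W s y"
proof (induction rule: equivclp_induct)
  case (step y z)
  have "word_act W s p = word_act W s q" if "cox_delete (cox_m W s) p q" for p q
    using that by (auto simp: cox_delete_def fun_eq_iff word_act_append word_act_replicate cox_refl_braid)
  with step show ?case by metis
qed simp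

lemma word_act_rev: "word_act W s (rev x) (word_act W s x v) = v"
  by (induction x arbitrary: v) (simp_all add: word_act_def cox_refl_invol)

lemma word_act_eq:
  assumes "word_val W s x = word_val W s y"
  shows "word_act W s x = word_act W s y"
proof
  fix v
  interpret group W by (rule is_group)
  have "word_val W s (rev y @ x) = \<one>\<^bsub>W\<^esub>"
    by (simp add: word_val_append word_val_rev assms word_val_closed l_inv)
  then have "equivclp (cox_delete (cox_m W s)) (rev y @ x) []"
    using cs by (simp add: coxeter_system_def)
  then have "word_act W s (rev y @ x) v = v"
    by (simp add: word_act_cong) (simp add: word_act_def)
  then have "word_act W s y (word_act W s (rev y) (word_act W s x v)) = word_act W s y v"
    by (simp add: word_act_append)
  then show "word_act W s x v = word_act W s y v"
    using word_act_rev[of "rev y"] by simp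
qed

lemma cox_act_word_val: "cox_act W s (word_val W s ws) = word_act W s ws"
  unfolding cox_act_def by (rule word_act_eq) (rule someI[of _ ws], simp)

lemma cox_act_one: "cox_act W s \<one>\<^bsub>W\<^esub> v = v"
  using cox_act_word_val[of "[]"] by (simp add: word_val_def word_act_def)

lemma cox_act_gen: "cox_act W s (s i) = cox_refl W s i"
proof -
  interpret group W by (rule is_group)
  show ?thesis
    using cox_act_word_val[of "[i]"] by (simp add: word_val_def word_act_def s_closed fun_eq_iff)
qed

lemma cox_act_mult:
  assumes "g \<in> carrier W" "h \<in> carrier W"
  shows "cox_act W s (g \<otimes>\<^bsub>W\<^esub> h) v = cox_act W s g (cox_act W s h v)"
proof -
  obtain x y where "word_val W s x = g" "word_val W s y = h"
    using assms word_val_surj by metis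
  then show ?thesis
    using cox_act_word_val[of "x @ y"] cox_act_word_val[of x] cox_act_word_val[of y]
    by (simp add: word_val_append word_act_append)
qed

lemma cox_act_linear:
  assumes "g \<in> carrier W"
  shows "linear (cox_act W s g)"
proof -
  have *: "linear (word_act W s ws)" for ws
  proof (induction ws)
    case Nil
    show ?case by (rule linearI) (simp_all add: word_act_def)
  next
    case (Cons i ws)
    have "word_act W s (i # ws) = cox_refl W s i \<circ> word_act W s ws"
      by (simp add: word_act_def fun_eq_iff)
    then show ?case using linear_compose[OF Cons cox_refl_linear] by metis
  qed
  obtain x where "word_val W s x = g" using assms word_val_surj by metis
  then show ?thesis using *[of x] cox_act_word_val[of x] by simp
qed

end

end

theory Submission
  imports Defs
begin

text \<open>
  Put \<open>\<gamma>\<^sub>i = \<beta> - t\<^sub>i \<alpha>\<^sub>i\<close>, which is again a positive root.  An inversion set containing \<open>\<beta>\<close> but not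
  \<open>\<alpha>\<^sub>i\<close> contains \<open>\<gamma>\<^sub>i\<close>.  If \<open>\<Phi>(x) \<inter> \<Phi>(y) = {\<beta>}\<close>, then each of the three \<open>\<alpha>\<^sub>i\<close> is missing from
  \<open>\<Phi>(x)\<close> or from \<open>\<Phi>(y)\<close>, so one of these sets misses two of them and contains the
  corresponding \<open>\<gamma>\<^sub>i, \<gamma>\<^sub>j\<close>.  The hypothesis on the \<open>m\<^sub>i\<close> is exactly \<open>\<langle>\<gamma>\<^sub>i, \<gamma>\<^sub>j\<rangle> \<le> -1\<close>: the two
  reflections generate an infinite dihedral group, and all its infinitely many positive roots are
  inverted together with \<open>\<gamma>\<^sub>i, \<gamma>\<^sub>j\<close>, whereas inversion sets are finite.

  For elementarity, a root dominated by \<open>\<beta> = s\<^sub>1 s\<^sub>2 s\<^sub>3 \<alpha>\<^sub>4\<close> and different from \<open>\<alpha>\<^sub>1, \<alpha>\<^sub>2, \<alpha>\<^sub>3\<close> is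
  carried by \<open>s\<^sub>3 s\<^sub>2 s\<^sub>1\<close> to a positive root dominated by \<open>\<alpha>\<^sub>4\<close>, hence to \<open>\<alpha>\<^sub>4\<close>; and \<open>\<alpha>\<^sub>i\<close> is
  separated from \<open>\<beta>\<close> inside a conjugate of the finite dihedral group generated by \<open>s\<^sub>i\<close> and \<open>s\<^sub>4\<close>.
\<close>

section \<open>Chebyshev polynomials of the second kind and alternating words\<close>

text \<open>The index is shifted: \<open>cheb c (k + 1)\<close> is the value \<open>U\<^sub>k(c)\<close>.\<close>

fun cheb :: "real \<Rightarrow> nat \<Rightarrow> real" where
  "cheb c 0 = 0"
| "cheb c (Suc 0) = 1"
| "cheb c (Suc (Suc k)) = 2 * c * cheb c (Suc k) - cheb c k"

lemma cheb_sin: "sin \<theta> * cheb (cos \<theta>) k = sin (real k * \<theta>)"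
proof (induction k rule: induct_nat_012)
  case (ge2 k)
  have "sin (real (Suc (Suc k)) * \<theta>) = sin (real (Suc k) * \<theta> + \<theta>)"
    "sin (real k * \<theta>) = sin (real (Suc k) * \<theta> - \<theta>)"
    by (simp_all add: algebra_simps)
  then have "sin (real (Suc (Suc k)) * \<theta>) = 2 * cos \<theta> * sin (real (Suc k) * \<theta>) - sin (real k * \<theta>)"
    by (simp only: sin_add[of "real (Suc k) * \<theta>" \<theta>] sin_diff[of "real (Suc k) * \<theta>" \<theta>]) simp
  then show ?case
    by (simp only: ge2(1)[symmetric] ge2(2)[symmetric]) (simp add: algebra_simps)
qed simp_all

lemma cheb_one: "cheb 1 k = real k"
  by (induction k rule: induct_nat_012) auto

text \<open>The value is \<open>sin (k\<theta>) / sin \<theta>\<close> with \<open>k\<theta>\<close>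
  between 0 and \<pi>. The encoding \<open>m = 0\<close> of \<infinity> gives
  \<open>pi / 0 = 0\<close>, so the argument is 1 and the value is \<open>k\<close>; at
  \<open>m = 1\<close> the denominator would vanish.\<close>

lemma cheb_cos_nonneg:
  assumes "m \<noteq> 1" and "k \<le> m \<or> m = 0"
  shows "0 \<le> cheb (cos (pi / real m)) k"
proof (cases "m = 0")
  case True
  then show ?thesis by (simp add: cheb_one)
next
  case False
  define \<theta> where "\<theta> = pi / real m"
  have m: "m \<ge> 2" using False assms(1) by simp
  have "0 < \<theta>" "\<theta> < pi" using m by (auto simp: \<theta>_def field_simps)
  then have "sin \<theta> > 0" by (simp add: sin_gt_zero)
  moreover have "0 \<le> real k * \<theta>" "real k * \<theta> \<le> pi"
    using False assms(2) by (auto simp: \<theta>_def field_simps)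
  then have "0 \<le> sin \<theta> * cheb (cos \<theta>) k" by (simp add: cheb_sin sin_ge_zero)
  ultimately show ?thesis by (simp add: \<theta>_def zero_le_mult_iff)
qed

lemma cheb_cos_end:
  assumes "m \<ge> 2"
  shows "cheb (cos (pi / real m)) m = 0" "cheb (cos (pi / real m)) (m - 1) = 1"
proof -
  define \<theta> where "\<theta> = pi / real m"
  have "0 < \<theta>" "\<theta> < pi" using assms by (auto simp: \<theta>_def field_simps)
  then have s: "sin \<theta> > 0" by (simp add: sin_gt_zero)
  have e: "real m * \<theta> = pi" "real (m - 1) * \<theta> = pi - \<theta>"
    using assms by (simp_all add: \<theta>_def field_simps of_nat_diff)
  have "sin \<theta> * cheb (cos \<theta>) m = 0" "sin \<theta> * cheb (cos \<theta>) (m - 1) = sin \<theta>"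
    by (simp_all only: cheb_sin e sin_pi sin_pi_minus)
  then show "cheb (cos (pi / real m)) m = 0" "cheb (cos (pi / real m)) (m - 1) = 1"
    using s by (simp_all add: \<theta>_def)
qed

text \<open>The increments do not decrease and the first one is 1. Nonnegativity is carried along
  because it allows the factor \<open>2 * c\<close> to be bounded below by 2.\<close>

lemma cheb_growth:
  assumes "c \<ge> 1"
  shows "0 \<le> cheb c k \<and> cheb c k + 1 \<le> cheb c (Suc k)"
proof (induction k)
  case (Suc k)
  then have "2 * cheb c (Suc k) \<le> 2 * c * cheb c (Suc k)"
    using assms by (intro mult_right_mono) auto
  with Suc show ?case unfolding cheb.simps(3) by linarith
qed simp

text \<open>The alternating word of length \<open>k\<close> in \<open>i, t\<close> whose last letter is \<open>t\<close>.\<close>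
primrec altw :: "'i \<Rightarrow> 'i \<Rightarrow> nat \<Rightarrow> 'i list" where
  "altw i t 0 = []"
| "altw i t (Suc k) = (if even k then t else i) # altw i t k"

lemma length_altw [simp]: "length (altw i t k) = k"
  by (induction k) auto

lemma altw_snoc: "altw t i (Suc k) = altw i t k @ [i]"
  by (induction k) auto

lemma altw_suffix: "\<exists>p. length p = k \<and> altw i t (k + n) = p @ altw i t n"
proof (induction k)
  case (Suc k)
  then obtain p where "length p = k" "altw i t (k + n) = p @ altw i t n" by blast
  then show ?case by (intro exI[of _ "(if even (k + n) then t else i) # p"]) auto
qed simp

lemma altw_double: "altw i t (2 * k) = concat (replicate k [i, t])"
  by (induction k) auto

definition root_refl :: "('g, 'b) monoid_scheme \<Rightarrow> ('i::finite \<Rightarrow> 'g) \<Rightarrow> real ^ 'i \<Rightarrow> real ^ 'i \<Rightarrow> real ^ 'i" where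
  "root_refl W s a v = v - (2 * cox_form W s v a) *\<^sub>R a"

definition cox_len :: "('g, 'b) monoid_scheme \<Rightarrow> ('i \<Rightarrow> 'g) \<Rightarrow> 'g \<Rightarrow> nat" where
  "cox_len W s w = (LEAST n. \<exists>ws. word_val W s ws = w \<and> length ws = n)"

lemma cox_len_le: "cox_len W s (word_val W s ws) \<le> length ws"
  unfolding cox_len_def by (rule Least_le) blast

section \<open>Every root is positive or negative\<close>

context
  fixes W :: "('g, 'b) monoid_scheme" and s :: "'i::finite \<Rightarrow> 'g"
  assumes cs: "coxeter_system W s"
begin

interpretation group W by (rule is_group[OF cs])

abbreviation "B \<equiv> cox_form W s"
abbreviation "act \<equiv> cox_act W s"
abbreviation "len \<equiv> cox_len W s"
abbreviation "val \<equiv> word_val W s"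

lemmas gen_closed [simp] = s_closed[OF cs]
lemmas val_closed [simp] = word_val_closed[OF cs]

lemma val_sing: "val [i] = s i"
  by (simp add: word_val_def)

lemma cox_form_sym: "B x y = B y x"
  unfolding cox_form_def
  by (subst sum.swap) (simp add: cox_m_sym[OF cs] mult.commute mult.left_commute)

lemma cox_form_linear_right:
  "B z (x + y) = B z x + B z y"
  "B z (x - y) = B z x - B z y"
  "B z (c *\<^sub>R x) = c * B z x"
  by (simp_all add: cox_form_sym[of z] cox_form_linear_left)

lemma cox_form_simple_self: "B (simple_root i) (simple_root i) = 1"
  by (simp add: cox_form_simple cox_m_diag[OF cs])

lemma cox_refl_form: "B (cox_refl W s i x) (cox_refl W s i y) = B x y"
  by (simp add: cox_refl_def cox_form_linear_left cox_form_linear_right cox_form_simple_self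
      cox_form_sym[of "simple_root i"] algebra_simps)

lemma word_act_form: "B (word_act W s ws x) (word_act W s ws y) = B x y"
  by (induction ws) (auto simp: word_act_def cox_refl_form)

lemma cox_act_form:
  assumes "w \<in> carrier W"
  shows "B (act w x) (act w y) = B x y"
  using word_val_surj[OF cs assms] by (metis cox_act_word_val[OF cs] word_act_form)

text \<open>Each reflection changes one coefficient, by exactly the Chebyshev recurrence. With
  \<open>z\<close> abstract, one computation serves both alternating words in two generators and
  pairs of roots with \<open>c \<ge> 1\<close>.\<close>

lemma alternating_refl:
  assumes "B a a = 1" "B b b = 1" "B a b = - c"
    and "z 0 = a"
    and "\<And>k. z (Suc k) = root_refl W s (if even k then b else a) (z k)"
  shows "z k = (if even k then cheb c (Suc k) *\<^sub>R a + cheb c k *\<^sub>R b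
                else cheb c (Suc k) *\<^sub>R b + cheb c k *\<^sub>R a)"
proof (induction k)
  case 0
  then show ?case using assms by simp
next
  case (Suc k)
  then show ?case using assms(1-3) cox_form_sym[of b a]
    by (auto simp: assms(5) root_refl_def cox_form_linear_left algebra_simps
        simp flip: scaleR_add_left scaleR_diff_left)
qed

lemma altw_act:
  fixes i t :: 'i
  defines "c \<equiv> cos (pi / real (cox_m W s i t))"
  shows "word_act W s (altw i t k) (simple_root i) =
    (if even k then cheb c (Suc k) *\<^sub>R simple_root i + cheb c k *\<^sub>R simple_root t
     else cheb c (Suc k) *\<^sub>R simple_root t + cheb c k *\<^sub>R simple_root i)"
  by (rule alternating_refl[of "simple_root i" "simple_root t" c
        "\<lambda>k. word_act W s (altw i t k) (simple_root i)"])
    (auto simp: word_act_def root_refl_def cox_refl_def cox_m_diag[OF cs] cox_form_simple c_def)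

section \<open>Length and its parity\<close>

lemma len_word:
  assumes "w \<in> carrier W"
  obtains ws where "val ws = w" "length ws = len w"
proof -
  obtain ws where "val ws = w" using word_val_surj[OF cs assms] .
  then have "\<exists>n ws. val ws = w \<and> length ws = n" by blast
  from LeastI_ex[OF this] show ?thesis using that unfolding cox_len_def by blast
qed

lemma len_mult_val: "w \<in> carrier W \<Longrightarrow> len (w \<otimes>\<^bsub>W\<^esub> val u) \<le> len w + length u"
  by (metis cox_len_le len_word length_append word_val_append[OF cs])

lemma len_mult_gen: "w \<in> carrier W \<Longrightarrow> len (w \<otimes>\<^bsub>W\<^esub> s i) \<le> len w + 1"
  using len_mult_val[of w "[i]"] by (simp add: val_sing)

lemma mult_gen_gen: "w \<in> carrier W \<Longrightarrow> w \<otimes>\<^bsub>W\<^esub> s i \<otimes>\<^bsub>W\<^esub> s i = w"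
  by (simp add: m_assoc s_sq[OF cs])

text \<open>Every relator has even length, so \<open>cox_delete\<close> preserves parity; this is
  the sign character.\<close>

lemma word_parity:
  assumes "val x = val y"
  shows "even (length x) \<longleftrightarrow> even (length y)"
proof -
  have "even (length p) \<longleftrightarrow> even (length q)" if "equivclp (cox_delete (cox_m W s)) p q" for p q
    using that
  proof (induction rule: equivclp_induct)
    case (step y z)
    have "even (length p) = even (length q)" if "cox_delete (cox_m W s) p q" for p q
      using that by (auto simp: cox_delete_def simp flip: altw_double)
    with step show ?case by metis
  qed simp
  moreover have "val (rev y @ x) = \<one>\<^bsub>W\<^esub>"
    by (simp add: word_val_append[OF cs] word_val_rev[OF cs] assms)
  then have "equivclp (cox_delete (cox_m W s)) (rev y @ x) []"
    using cs by (simp add: coxeter_system_def)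
  ultimately have "even (length (rev y @ x)) = even (length ([] :: 'i list))" by blast
  then show ?thesis by simp
qed

lemma len_mult_gen_neq:
  assumes "w \<in> carrier W"
  shows "len (w \<otimes>\<^bsub>W\<^esub> s i) \<noteq> len w"
proof
  assume eq: "len (w \<otimes>\<^bsub>W\<^esub> s i) = len w"
  obtain x where x: "val x = w" "length x = len w" using len_word[OF assms] .
  obtain y where y: "val y = w \<otimes>\<^bsub>W\<^esub> s i" "length y = len (w \<otimes>\<^bsub>W\<^esub> s i)"
    using len_word assms by (metis m_closed gen_closed)
  have "val (x @ [i]) = val y" using x y by (simp add: word_val_append[OF cs] val_sing)
  from word_parity[OF this] show False using x y eq by simp
qed

text \<open>The product ends in an alternating word of \<open>m + 1\<close> letters. The relator of
  length \<open>2 * m\<close> equates that word with the inverse of the other \<open>m - 1\<close>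
  letters, so \<open>v\<close> is followed by only \<open>(k - m) + (m - 1) = k - 1\<close>
  letters.\<close>

lemma len_altw_braid:
  assumes "cox_m W s i t \<noteq> 0" "cox_m W s i t \<le> k" "v \<in> carrier W"
  shows "len (v \<otimes>\<^bsub>W\<^esub> val (altw i t k) \<otimes>\<^bsub>W\<^esub> s i) < len v + k"
proof -
  define m where "m = cox_m W s t i"
  have m: "m \<noteq> 0" "m \<le> k" using assms cox_m_sym[OF cs, of i t] by (auto simp: m_def)
  obtain p where p: "length p = m - 1" "altw t i ((m - 1) + Suc m) = p @ altw t i (Suc m)"
    using altw_suffix[of "m - 1" t i "Suc m"] by blast
  obtain q where q: "length q = k - m" "altw t i ((k - m) + Suc m) = q @ altw t i (Suc m)"
    using altw_suffix[of "k - m" t i "Suc m"] by blast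
  have "val (concat (replicate n [t, i])) = (s t \<otimes>\<^bsub>W\<^esub> s i) [^]\<^bsub>W\<^esub> n" for n :: nat
  proof (induction n)
    case (Suc n)
    have "(s t \<otimes>\<^bsub>W\<^esub> s i) [^]\<^bsub>W\<^esub> Suc n = s t \<otimes>\<^bsub>W\<^esub> s i \<otimes>\<^bsub>W\<^esub> (s t \<otimes>\<^bsub>W\<^esub> s i) [^]\<^bsub>W\<^esub> n"
      by (rule nat_pow_Suc2) simp
    with Suc show ?case by (simp add: word_val_def m_assoc)
  qed (simp add: word_val_def)
  then have "val (altw t i (2 * m)) = \<one>\<^bsub>W\<^esub>"
    unfolding altw_double m_def cox_m_def by (simp add: pow_ord_eq_1)
  moreover have "(m - 1) + Suc m = 2 * m" using m by simp
  ultimately have "val p \<otimes>\<^bsub>W\<^esub> val (altw t i (Suc m)) = \<one>\<^bsub>W\<^esub>"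
    using p by (metis word_val_append[OF cs])
  then have "inv\<^bsub>W\<^esub> (val (altw t i (Suc m))) = val p" by (rule inv_equality) simp_all
  then have "val (altw t i (Suc m)) = val (rev p)"
    by (metis word_val_rev[OF cs] inv_inv val_closed)
  moreover have "v \<otimes>\<^bsub>W\<^esub> val (altw i t k) \<otimes>\<^bsub>W\<^esub> s i = v \<otimes>\<^bsub>W\<^esub> val (altw t i (Suc k))"
    unfolding altw_snoc by (simp add: word_val_append[OF cs] val_sing m_assoc assms)
  moreover have "Suc k = (k - m) + Suc m" using m by simp
  ultimately have "v \<otimes>\<^bsub>W\<^esub> val (altw i t k) \<otimes>\<^bsub>W\<^esub> s i = v \<otimes>\<^bsub>W\<^esub> val (q @ rev p)"
    using q by (metis word_val_append[OF cs])
  then show ?thesis using len_mult_val[OF assms(3), of "q @ rev p"] p(1) q(1) m by simp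
qed

lemma simple_root_nth: "simple_root i $ j = (if j = i then 1 else 0)"
  by (simp add: simple_root_def axis_def)

text \<open>
  Induction on the length: \<open>w\<close> is split as \<open>v\<close> times a longest alternating word in \<open>i\<close> and the
  last letter \<open>t\<close> of a reduced word.  Maximality makes \<open>v\<close> lengthen under both \<open>s i\<close> and \<open>s t\<close>,
  and the alternating word sends the \<open>i\<close>-th simple root to a nonnegative combination of the
  \<open>i\<close>-th and \<open>t\<close>-th because it is too short for the braid relation to apply.
\<close>
lemma act_simple_nonneg:
  assumes "w \<in> carrier W" "len w < len (w \<otimes>\<^bsub>W\<^esub> s i)"
  shows "0 \<le> act w (simple_root i) $ j"
  using assms
proof (induction "len w" arbitrary: w i rule: less_induct)
  case (less w i)
  note w = less.prems(1)
  obtain ws where ws: "val ws = w" "length ws = len w" using len_word[OF w] .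
  show ?case
  proof (cases ws rule: rev_cases)
    case Nil
    then have "w = \<one>\<^bsub>W\<^esub>" using ws by (simp add: word_val_def)
    then show ?thesis by (simp add: cox_act_one[OF cs] simple_root_nth)
  next
    case (snoc us t)
    have wus: "w = val us \<otimes>\<^bsub>W\<^esub> s t" using ws snoc by (simp add: word_val_append[OF cs] val_sing)
    have lw: "len w = Suc (length us)" using ws snoc by simp
    have "t \<noteq> i"
    proof
      assume "t = i"
      then have "len (w \<otimes>\<^bsub>W\<^esub> s i) \<le> length us"
        using cox_len_le[of W s us] by (simp add: wus mult_gen_gen)
      then show False using less.prems lw by simp
    qed
    define P where "P k \<longleftrightarrow> (\<exists>v\<in>carrier W. w = v \<otimes>\<^bsub>W\<^esub> val (altw i t k) \<and> len w = len v + k)" for k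
    have "len (val us) \<le> length us" by (rule cox_len_le)
    moreover have "len w \<le> len (val us) + 1" unfolding wus by (rule len_mult_gen) simp
    ultimately have "len w = len (val us) + 1" using lw by simp
    then have P1: "P 1" unfolding P_def using wus by (intro bexI[of _ "val us"]) (auto simp: val_sing)
    have Pbound: "\<And>k. P k \<Longrightarrow> k \<le> len w" by (auto simp: P_def)
    define k where "k = (GREATEST k. P k)"
    have "P k" unfolding k_def by (rule GreatestI_nat[of P, OF P1 Pbound])
    then obtain v where v: "v \<in> carrier W" "w = v \<otimes>\<^bsub>W\<^esub> val (altw i t k)" "len w = len v + k"
      unfolding P_def by blast
    have kmax: "\<not> P (Suc k)" using Greatest_le_nat[of P "Suc k", OF _ Pbound] by (auto simp: k_def)
    have "1 \<le> k" unfolding k_def by (rule Greatest_le_nat[of P, OF P1 Pbound])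
    then obtain k' where k': "k = Suc k'" by (cases k) auto
    \<comment> \<open>\<open>p\<close> is the first letter of the alternating word, \<open>q\<close>
      the letter that would prolong it to the left; together they are \<open>i\<close> and
      \<open>t\<close>. If \<open>p\<close> shortened \<open>v\<close>, then \<open>w\<close> would
      be too short; if \<open>q\<close> did, \<open>k\<close> would not be maximal.\<close>
    define p where "p = (if even k' then t else i)"
    define q where "q = (if even k then t else i)"
    have "len v < len (v \<otimes>\<^bsub>W\<^esub> s p)"
    proof (rule ccontr)
      assume "\<not> ?thesis"
      then have "len (v \<otimes>\<^bsub>W\<^esub> s p) < len v" using len_mult_gen_neq[OF v(1), of p] by simp
      moreover have "w = (v \<otimes>\<^bsub>W\<^esub> s p) \<otimes>\<^bsub>W\<^esub> val (altw i t k')"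
        using v by (simp add: k' p_def word_val_def m_assoc val_closed[unfolded word_val_def])
      ultimately show False using len_mult_val[of "v \<otimes>\<^bsub>W\<^esub> s p" "altw i t k'"] v k' by simp
    qed
    moreover have "len v < len (v \<otimes>\<^bsub>W\<^esub> s q)"
    proof (rule ccontr)
      assume "\<not> ?thesis"
      then have 1: "len (v \<otimes>\<^bsub>W\<^esub> s q) < len v" using len_mult_gen_neq[OF v(1), of q] by simp
      have "len v \<le> len (v \<otimes>\<^bsub>W\<^esub> s q) + 1"
        using len_mult_gen[of "v \<otimes>\<^bsub>W\<^esub> s q" q] v(1) by (simp add: mult_gen_gen)
      with 1 v have "len w = len (v \<otimes>\<^bsub>W\<^esub> s q) + Suc k" by simp
      moreover have "val (altw i t (Suc k)) = s q \<otimes>\<^bsub>W\<^esub> val (altw i t k)"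
        by (simp add: q_def word_val_def)
      then have "w = (v \<otimes>\<^bsub>W\<^esub> s q) \<otimes>\<^bsub>W\<^esub> val (altw i t (Suc k))"
        using v by (simp add: mult_gen_gen flip: m_assoc)
      ultimately have "P (Suc k)" unfolding P_def using v(1) by (intro bexI[of _ "v \<otimes>\<^bsub>W\<^esub> s q"]) auto
      then show False using kmax by simp
    qed
    moreover have "len v < len w" using v k' by simp
    ultimately have "0 \<le> act v (simple_root p) $ j" "0 \<le> act v (simple_root q) $ j"
      using less.hyps v(1) by blast+
    then have nn: "0 \<le> act v (simple_root i) $ j" "0 \<le> act v (simple_root t) $ j"
      by (auto simp: p_def q_def k' split: if_splits)
    \<comment> \<open>Otherwise the braid relation would make \<open>w\<close> times
      \<open>s i\<close> shorter than \<open>w\<close>. Strictness brings the index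
      \<open>Suc k\<close> within the range of \<open>cheb_cos_nonneg\<close>.\<close>
    have km: "k < cox_m W s i t \<or> cox_m W s i t = 0"
      using len_altw_braid[of i t k v] v less.prems(2) by fastforce
    have "cox_m W s i t \<noteq> 1" using cox_m_neq_1[OF cs] \<open>t \<noteq> i\<close> by metis
    then have cn: "0 \<le> cheb (cos (pi / real (cox_m W s i t))) (Suc k)"
      "0 \<le> cheb (cos (pi / real (cox_m W s i t))) k"
      using km by (auto intro!: cheb_cos_nonneg simp del: cheb.simps)
    have "act w (simple_root i) = act v (word_act W s (altw i t k) (simple_root i))"
      by (simp add: v(2) cox_act_mult[OF cs] v(1) cox_act_word_val[OF cs])
    then show ?thesis
      using nn cn cox_act_linear[OF cs v(1)]
      by (simp add: altw_act linear_add linear_scale del: cheb.simps)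
  qed
qed

section \<open>Roots and their signs\<close>

lemma roots_act: "r \<in> roots W s \<Longrightarrow> w \<in> carrier W \<Longrightarrow> act w r \<in> roots W s"
  unfolding roots_def using cox_act_mult[OF cs] m_closed by (auto; metis)

lemma simple_root_roots: "simple_root i \<in> roots W s"
  unfolding roots_def using cox_act_one[OF cs] one_closed by (auto; metis)

lemma roots_refl: "r \<in> roots W s \<Longrightarrow> cox_refl W s i r \<in> roots W s"
  using roots_act[of r "s i"] by (simp add: cox_act_gen[OF cs])

lemma roots_uminus: "r \<in> roots W s \<Longrightarrow> - r \<in> roots W s"
proof -
  assume "r \<in> roots W s"
  then obtain w i where w: "w \<in> carrier W" "r = act w (simple_root i)" unfolding roots_def by blast
  have "- r = act w (cox_refl W s i (simple_root i))"
    using cox_act_linear[OF cs w(1)] by (simp add: w cox_refl_simple_self[OF cs] linear_neg)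
  then show ?thesis using w(1) roots_act roots_refl simple_root_roots by metis
qed

lemma root_form: "r \<in> roots W s \<Longrightarrow> B r r = 1"
  unfolding roots_def using cox_act_form cox_form_simple_self by auto

lemma root_nonzero: "r \<in> roots W s \<Longrightarrow> r \<noteq> 0"
  using root_form[of r] by (auto simp: cox_form_def)

text \<open>Multiplication by \<open>s i\<close> always changes the length, so
  \<open>act_simple_nonneg\<close> applies either to \<open>w\<close>, giving \<open>r\<close>, or
  to \<open>w\<close> times \<open>s i\<close>, giving \<open>- r\<close>.\<close>

lemma root_dichotomy:
  assumes "r \<in> roots W s"
  shows "(\<forall>j. 0 \<le> r $ j) \<or> (\<forall>j. r $ j \<le> 0)"
proof -
  obtain w i where w: "w \<in> carrier W" "r = act w (simple_root i)" using assms unfolding roots_def by blast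
  show ?thesis
  proof (cases "len w < len (w \<otimes>\<^bsub>W\<^esub> s i)")
    case True
    then show ?thesis using act_simple_nonneg w by blast
  next
    case False
    then have "len (w \<otimes>\<^bsub>W\<^esub> s i) < len (w \<otimes>\<^bsub>W\<^esub> s i \<otimes>\<^bsub>W\<^esub> s i)"
      using len_mult_gen_neq[OF w(1), of i] by (simp add: mult_gen_gen w)
    then have "0 \<le> act (w \<otimes>\<^bsub>W\<^esub> s i) (simple_root i) $ j" for j
      using act_simple_nonneg w by simp
    moreover have "act (w \<otimes>\<^bsub>W\<^esub> s i) (simple_root i) = - r"
      using cox_act_linear[OF cs w(1)] 
      by (simp add: w cox_act_mult[OF cs] cox_act_gen[OF cs] cox_refl_simple_self[OF cs] linear_neg)
    ultimately show ?thesis by simp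
  qed
qed

lemma neg_root_iff: "r \<in> roots W s \<Longrightarrow> neg_root W s r \<longleftrightarrow> (\<forall>j. r $ j \<le> 0)"
  using roots_uminus by (auto simp: neg_root_def pos_roots_def)

lemma pos_root_iff: "r \<in> roots W s \<Longrightarrow> r \<in> pos_roots W s \<longleftrightarrow> \<not> neg_root W s r"
  using root_dichotomy[of r] root_nonzero[of r]
  by (auto simp: neg_root_iff pos_roots_def vec_eq_iff) (metis order_antisym)+

lemma pos_roots_roots: "r \<in> pos_roots W s \<Longrightarrow> r \<in> roots W s"
  by (simp add: pos_roots_def)

lemma simple_root_pos: "simple_root i \<in> pos_roots W s"
  by (simp add: pos_roots_def simple_root_roots simple_root_nth)

lemma neg_root_uminus_pos: "r \<in> pos_roots W s \<Longrightarrow> neg_root W s (- r)"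
  by (simp add: neg_root_def)

text \<open>Since roots have norm 1, a positive root other than \<open>simple_root i\<close> has a
  positive coordinate besides the \<open>i\<close>-th. The reflection leaves it unchanged, and the
  dichotomy settles all the others.\<close>

lemma cox_refl_pos:
  assumes "r \<in> pos_roots W s" "r \<noteq> simple_root i"
  shows "cox_refl W s i r \<in> pos_roots W s"
proof -
  have r: "r \<in> roots W s" "\<And>j. 0 \<le> r $ j" using assms by (auto simp: pos_roots_def)
  have "\<exists>j. j \<noteq> i \<and> r $ j \<noteq> 0"
  proof (rule ccontr)
    assume "\<not> ?thesis"
    then have e: "r = (r $ i) *\<^sub>R simple_root i" by (auto simp: vec_eq_iff simple_root_nth)
    have "B r r = (r $ i) * (r $ i)"
      by (subst (1 2) e) (simp add: cox_form_linear_left cox_form_linear_right cox_form_simple_self)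
    then have "(r $ i)\<^sup>2 = 1" using root_form[OF r(1)] by (simp add: power2_eq_square)
    then have "r $ i = 1" using r(2)[of i] by (simp add: power2_eq_1_iff)
    then show False using e assms(2) by simp
  qed
  then obtain j where j: "j \<noteq> i" "r $ j \<noteq> 0" by blast
  then have "cox_refl W s i r $ j > 0"
    using r(2)[of j] by (simp add: cox_refl_def simple_root_nth)
  then show ?thesis
    using root_dichotomy[OF roots_refl[OF r(1), of i]] roots_refl[OF r(1), of i]
    by (auto simp: pos_roots_def) (meson not_le)
qed

section \<open>Inversion sets\<close>

text \<open>The last letter acts first and keeps every positive root positive except its own simple
  root, so each letter adds at most one root to the set.\<close>

lemma finite_negated: "finite {r \<in> pos_roots W s. neg_root W s (word_act W s ws r)}"
proof (induction ws rule: rev_induct)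
  case Nil
  have "{r \<in> pos_roots W s. neg_root W s (word_act W s [] r)} = {}"
    using pos_root_iff pos_roots_roots by (simp add: word_act_def) blast
  then show ?case by (metis finite.emptyI)
next
  case (snoc i ws)
  let ?N = "{r \<in> pos_roots W s. neg_root W s (word_act W s ws r)}"
  have "{r \<in> pos_roots W s. neg_root W s (word_act W s (ws @ [i]) r)}
      \<subseteq> insert (simple_root i) (cox_refl W s i ` ?N)" (is "?A \<subseteq> _")
  proof
    fix r assume r: "r \<in> ?A"
    show "r \<in> insert (simple_root i) (cox_refl W s i ` ?N)"
    proof (cases "r = simple_root i")
      case False
      then have "cox_refl W s i r \<in> ?N"
        using r cox_refl_pos[of r i] by (simp add: word_act_append) (simp add: word_act_def)
      then have "cox_refl W s i (cox_refl W s i r) \<in> cox_refl W s i ` ?N" by (rule imageI)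
      then show ?thesis by (simp add: cox_refl_invol[OF cs])
    qed simp
  qed
  then show ?case using snoc by (meson finite.insertI finite_imageI finite_subset)
qed

lemma finite_inversion_set:
  assumes "w \<in> carrier W"
  shows "finite (inversion_set W s w)"
proof -
  obtain ws where "val ws = inv\<^bsub>W\<^esub> w" using word_val_surj[OF cs inv_closed[OF assms]] .
  then have "act (inv\<^bsub>W\<^esub> w) = word_act W s ws" using cox_act_word_val[OF cs, of ws] by simp
  then show ?thesis using finite_negated[of ws] by (simp add: inversion_set_def)
qed

text \<open>If \<open>w\<close> carries a simple root to \<open>a\<close>, the reflection in
  \<open>a\<close> is the conjugate by \<open>w\<close> of the simple reflection.\<close>

lemma root_refl_roots:
  assumes "a \<in> roots W s" "v \<in> roots W s"
  shows "root_refl W s a v \<in> roots W s"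
proof -
  obtain w i where w: "w \<in> carrier W" "a = act w (simple_root i)" using assms unfolding roots_def by blast
  define u where "u = act (inv\<^bsub>W\<^esub> w) v"
  have v: "v = act w u"
    using w(1) cox_act_mult[OF cs w(1) inv_closed[OF w(1)], of v]
    by (simp add: u_def cox_act_one[OF cs])
  have "root_refl W s a v = act w (cox_refl W s i u)"
    using cox_act_linear[OF cs w(1)]
    by (simp add: root_refl_def cox_refl_def v w cox_act_form linear_diff linear_scale)
  moreover have "u \<in> roots W s" using roots_act assms w(1) by (simp add: u_def)
  ultimately show ?thesis using w(1) roots_act roots_refl by metis
qed

lemma inversion_set_iff:
  assumes "w \<in> carrier W" "r \<in> pos_roots W s"
  shows "r \<in> inversion_set W s w \<longleftrightarrow> (\<forall>j. act (inv\<^bsub>W\<^esub> w) r $ j \<le> 0)"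
proof -
  have "act (inv\<^bsub>W\<^esub> w) r \<in> roots W s" using assms by (intro roots_act pos_roots_roots) auto
  from neg_root_iff[OF this] show ?thesis using assms(2) by (simp add: inversion_set_def)
qed

lemma not_inversion_set_iff:
  assumes "w \<in> carrier W" "r \<in> pos_roots W s"
  shows "r \<notin> inversion_set W s w \<longleftrightarrow> (\<forall>j. 0 \<le> act (inv\<^bsub>W\<^esub> w) r $ j)"
proof -
  have act: "act (inv\<^bsub>W\<^esub> w) r \<in> roots W s" using assms by (intro roots_act pos_roots_roots) auto
  have "r \<notin> inversion_set W s w \<longleftrightarrow> act (inv\<^bsub>W\<^esub> w) r \<in> pos_roots W s"
    unfolding pos_root_iff[OF act] using assms(2) by (simp add: inversion_set_def)
  then show ?thesis using act by (simp add: pos_roots_def)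
qed

text \<open>Otherwise reflecting alternately in \<open>a\<close> and \<open>b\<close> gives
  infinitely many roots that are nonnegative combinations of both, hence all inverted by
  \<open>w\<close>, against finiteness.\<close>

lemma inversion_set_form_gt:
  assumes w: "w \<in> carrier W" and a: "a \<in> inversion_set W s w" and b: "b \<in> inversion_set W s w"
  shows "B a b > -1"
proof (rule ccontr)
  assume "\<not> ?thesis"
  define c where "c = - B a b"
  have c: "c \<ge> 1" using \<open>\<not> B a b > -1\<close> by (simp add: c_def)
  have pos: "a \<in> pos_roots W s" "b \<in> pos_roots W s" using a b by (auto simp: inversion_set_def)
  define z where "z = rec_nat a (\<lambda>k. root_refl W s (if even k then b else a))"
  have z: "z k = (if even k then cheb c (Suc k) *\<^sub>R a + cheb c k *\<^sub>R b
                else cheb c (Suc k) *\<^sub>R b + cheb c k *\<^sub>R a)" for k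
    by (rule alternating_refl) (simp_all add: z_def c_def root_form pos pos_roots_roots)
  have zroot: "z k \<in> roots W s" for k
    by (induction k) (simp_all add: z_def pos pos_roots_roots root_refl_roots)
  note g = cheb_growth[OF c]
  have nn: "0 \<le> cheb c k" for k using g by blast
  have "z k \<in> inversion_set W s w" for k
  proof -
    have p: "z k \<in> pos_roots W s" using zroot[of k] pos nn
      by (simp add: pos_roots_def z del: cheb.simps)
    have "act (inv\<^bsub>W\<^esub> w) a $ j \<le> 0" "act (inv\<^bsub>W\<^esub> w) b $ j \<le> 0" for j
      using inversion_set_iff[OF w] pos a b by auto
    then have "act (inv\<^bsub>W\<^esub> w) (z k) $ j \<le> 0" for j
      using cox_act_linear[OF cs inv_closed[OF w]] nn
      by (simp add: z linear_add linear_scale add_nonpos_nonpos mult_nonneg_nonpos del: cheb.simps)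
    then show ?thesis using inversion_set_iff[OF w p] by blast
  qed
  then have "finite (range z)"
    using finite_inversion_set[OF w] by (meson finite_subset image_subsetI)
  define h where "h x = (\<Sum>j\<in>UNIV. x $ j)" for x :: "real ^ 'i"
  have hpos: "0 < h r" if "r \<in> pos_roots W s" for r
  proof -
    have nonneg: "0 \<le> r $ j" for j using that by (simp add: pos_roots_def)
    have "r \<noteq> 0" using root_nonzero that pos_roots_roots by blast
    then obtain j where "r $ j \<noteq> 0" by (auto simp: vec_eq_iff)
    then show ?thesis unfolding h_def
      using nonneg by (intro sum_pos2[of UNIV j]) (auto simp: order_less_le)
  qed
  have hz: "h (z k) = (if even k then cheb c (Suc k) * h a + cheb c k * h b
                else cheb c (Suc k) * h b + cheb c k * h a)" for k
    by (simp add: z h_def sum.distrib sum_distrib_left del: cheb.simps)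
  have "h (z k) < h (z (Suc k))" for k
  proof -
    \<comment> \<open>\<open>z k\<close> and \<open>z (Suc k)\<close> share one coefficient; the
      other rises from \<open>cheb c k\<close> to \<open>cheb c (Suc (Suc k))\<close>.\<close>
    have "cheb c k < cheb c (Suc (Suc k))" using g[of k] g[of "Suc k"] by linarith
    then show ?thesis using hpos[OF pos(1)] hpos[OF pos(2)]
      by (simp add: hz mult_strict_right_mono del: cheb.simps)
  qed
  then have "strict_mono (\<lambda>k. h (z k))" by (simp add: strict_mono_Suc_iff)
  then have "inj z" by (metis (mono_tags, lifting) injI strict_mono_eq)
  then show False using \<open>finite (range z)\<close> finite_imageD by blast
qed

text \<open>The witness is the longest element of the dihedral group times \<open>s i\<close>.\<close>
lemma dihedral_separation:
  assumes "cox_m W s i t \<ge> 2"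
  obtains u where "u \<in> carrier W" "act u (simple_root i) \<in> pos_roots W s"
    "neg_root W s (act u (cox_refl W s i (simple_root t)))"
proof -
  define m where "m = cox_m W s i t"
  define c where "c = cos (pi / real m)"
  have m: "m \<ge> 2" using assms by (simp add: m_def)
  note e = cheb_cos_end[OF m, folded c_def]
  define x where "x = (if even m then simple_root t else simple_root i :: real ^ 'i)"
  define y where "y = (if even m then simple_root i else simple_root t :: real ^ 'i)"
  obtain n where n: "m = Suc (Suc n)" using m by (metis add_2_eq_Suc le_Suc_ex)
  have Suc: "Suc (m - 1) = m" "even (m - 1) \<longleftrightarrow> odd m" using m by auto
  have 1: "word_act W s (altw i t (m - 1)) (simple_root i) = y"
    using e m by (simp add: altw_act Suc y_def del: altw.simps cheb.simps flip: m_def c_def)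
  define d where "d = word_act W s (altw i t (m - 1)) (cox_refl W s i (simple_root t))"
  \<comment> \<open>With \<open>s i\<close> appended the word becomes the longest element. It sends
    \<open>simple_root t\<close> to a negative simple root, since the Chebyshev values at
    \<open>m - 1\<close>, \<open>m\<close>, \<open>m + 1\<close> are 1, 0, -1.\<close>
  have "altw i t (m - 1) @ [i] = altw t i m" using altw_snoc[of t i "m - 1"] by (simp only: Suc)
  then have "d = word_act W s (altw t i m) (simple_root t)"
    using word_act_append[of W s "altw i t (m - 1)" "[i]"] by (simp add: d_def word_act_def)
  also have "\<dots> = - x"
  proof -
    have "cheb c (Suc m) = - 1" using e by (simp add: n)
    then show ?thesis using e 
      by (simp add: altw_act x_def cox_m_sym[OF cs, of t i] del: cheb.simps flip: m_def c_def)
  qed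
  finally have "d = - x" .
  then have "neg_root W s d" using simple_root_pos by (simp add: x_def neg_root_uminus_pos)
  moreover have "y \<in> pos_roots W s" using simple_root_pos by (simp add: y_def)
  ultimately show ?thesis
    using 1 that[of "val (altw i t (m - 1))"] by (simp add: cox_act_word_val[OF cs] d_def)
qed

lemma inversion_set_summand:
  assumes "w \<in> carrier W" "g \<in> pos_roots W s" "a \<in> pos_roots W s" "0 \<le> t"
    and "g + t *\<^sub>R a \<in> inversion_set W s w" "a \<notin> inversion_set W s w"
  shows "g \<in> inversion_set W s w"
proof -
  have "act (inv\<^bsub>W\<^esub> w) (g + t *\<^sub>R a) $ j \<le> 0" for j
    using assms inversion_set_iff[of w "g + t *\<^sub>R a"] by (simp add: inversion_set_def)
  moreover have "0 \<le> t * act (inv\<^bsub>W\<^esub> w) a $ j" for j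
    using assms not_inversion_set_iff[of w a] by simp
  ultimately have "act (inv\<^bsub>W\<^esub> w) g $ j \<le> 0" for j
    using cox_act_linear[OF cs inv_closed[OF assms(1)]]
    by (simp add: linear_add linear_scale) (smt (verit))
  then show ?thesis using inversion_set_iff[OF assms(1,2)] by simp
qed

section \<open>Domination and the root \<open>\<beta>\<close>\<close>

lemma cox_refl_simple:
  "cox_refl W s i (simple_root j) =
    simple_root j + (2 * cos (pi / real (cox_m W s i j))) *\<^sub>R simple_root i"
  by (simp add: cox_refl_def cox_form_simple cox_m_sym[OF cs, of j i])

lemma cox_refl_simple_commuting:
  "cox_m W s i j = 2 \<Longrightarrow> cox_refl W s i (simple_root j) = simple_root j"
  by (simp add: cox_refl_simple)

lemma cox_refl_add: "cox_refl W s i (x + y) = cox_refl W s i x + cox_refl W s i y"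
  and cox_refl_scale: "cox_refl W s i (c *\<^sub>R x) = c *\<^sub>R cox_refl W s i x"
  by (simp_all add: cox_refl_linear linear_add linear_scale)

lemma dominatesD:
  assumes "dominates W s b g" "v \<in> carrier W" "neg_root W s (act v b)"
  shows "neg_root W s (act v g)"
proof -
  have "inv\<^bsub>W\<^esub> v \<in> carrier W" "inv\<^bsub>W\<^esub> (inv\<^bsub>W\<^esub> v) = v" using assms(2) by simp_all
  then show ?thesis using assms unfolding dominates_def by metis
qed

text \<open>\<open>s p\<close> and \<open>s q\<close> fix \<open>simple_root n\<close>, which is
  orthogonal to their roots. Applying them before the element of \<open>dihedral_separation\<close>
  strips the two outer reflections and leaves \<open>simple_root n\<close> alone.\<close>

lemma not_dominates_simple:
  assumes "cox_m W s n l \<ge> 2" "cox_m W s n p = 2" "cox_m W s n q = 2"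
  shows "\<not> dominates W s (cox_refl W s p (cox_refl W s q (cox_refl W s n (simple_root l)))) (simple_root n)"
    (is "\<not> dominates W s ?b _")
proof
  assume d: "dominates W s ?b (simple_root n)"
  obtain u where u: "u \<in> carrier W" "act u (simple_root n) \<in> pos_roots W s"
    "neg_root W s (act u (cox_refl W s n (simple_root l)))"
    using dihedral_separation[OF assms(1)] .
  have v: "act (u \<otimes>\<^bsub>W\<^esub> (s q \<otimes>\<^bsub>W\<^esub> s p)) x = act u (cox_refl W s q (cox_refl W s p x))" for x
    using u(1) by (simp add: cox_act_mult[OF cs] cox_act_gen[OF cs])
  have "cox_refl W s q (cox_refl W s p (simple_root n)) = simple_root n"
    using assms cox_m_sym[OF cs] by (simp add: cox_refl_simple_commuting)
  moreover have "neg_root W s (act (u \<otimes>\<^bsub>W\<^esub> (s q \<otimes>\<^bsub>W\<^esub> s p)) ?b)"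
    using u(3) by (simp add: v cox_refl_invol[OF cs])
  from dominatesD[OF d _ this]
  have "neg_root W s (act (u \<otimes>\<^bsub>W\<^esub> (s q \<otimes>\<^bsub>W\<^esub> s p)) (simple_root n))" using u(1) by simp
  ultimately have "neg_root W s (act u (simple_root n))" by (simp add: v)
  then show False using u(2) pos_root_iff pos_roots_roots by blast
qed

section \<open>The star diagram: three commuting nodes joined to the centre \<open>l\<close>\<close>

context
  fixes i j k l :: 'i and t :: "'i \<Rightarrow> real" and \<beta> :: "real ^ 'i"
  assumes distinct: "distinct [i, j, k, l]"
    and commuting: "cox_m W s i j = 2" "cox_m W s i k = 2" "cox_m W s j k = 2"
    and large: "\<And>n. n \<in> {i, j, k} \<Longrightarrow> cox_m W s n l \<ge> 3"
  defines t_def: "t \<equiv> \<lambda>n. 2 * cos (pi / real (cox_m W s n l))"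
    and \<beta>_def: "\<beta> \<equiv> t i *\<^sub>R simple_root i + t j *\<^sub>R simple_root j + t k *\<^sub>R simple_root k + simple_root l"
begin

lemma commuting': "cox_m W s j i = 2" "cox_m W s k i = 2" "cox_m W s k j = 2"
  using commuting cox_m_sym[OF cs] by metis+

lemma coeff_pos:
  assumes "n \<in> {i, j, k}"
  shows "t n > 0"
  using large[OF assms] unfolding t_def by (auto intro!: cos_gt_zero simp: field_simps)

text \<open>Each order puts a different reflection innermost, as \<open>not_dominates_simple\<close>
  requires for the corresponding simple root.\<close>

lemma star_root_eq:
  "\<beta> = cox_refl W s i (cox_refl W s j (cox_refl W s k (simple_root l)))"
  "\<beta> = cox_refl W s i (cox_refl W s k (cox_refl W s j (simple_root l)))"
  "\<beta> = cox_refl W s j (cox_refl W s k (cox_refl W s i (simple_root l)))"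
  by (simp_all add: \<beta>_def t_def cox_refl_add cox_refl_scale cox_refl_simple commuting commuting')

lemma star_root_pos: "\<beta> \<in> pos_roots W s"
proof -
  have "\<beta> \<in> roots W s" unfolding star_root_eq(1) by (intro roots_refl simple_root_roots)
  then show ?thesis using coeff_pos by (simp add: pos_roots_def \<beta>_def simple_root_nth less_imp_le)
qed

lemma star_root_elementary: "elementary_root W s \<beta>"
  unfolding elementary_root_def
proof (intro conjI notI)
  show "\<beta> \<in> pos_roots W s" by (rule star_root_pos)
  assume "\<exists>\<alpha>\<in>pos_roots W s - {\<beta>}. dominates W s \<beta> \<alpha>"
  then obtain g where g: "g \<in> pos_roots W s" "g \<noteq> \<beta>" "dominates W s \<beta> g" by blast
  have ge2: "cox_m W s n l \<ge> 2" if "n \<in> {i, j, k}" for n using large[OF that] by simp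
  have "g \<noteq> simple_root i"
    using not_dominates_simple[of i l j k] g(3) commuting commuting' ge2 star_root_eq(3) by auto
  moreover have "g \<noteq> simple_root j"
    using not_dominates_simple[of j l i k] g(3) commuting commuting' ge2 star_root_eq(2) by auto
  moreover have "g \<noteq> simple_root k"
    using not_dominates_simple[of k l i j] g(3) commuting commuting' ge2 star_root_eq(1) by auto
  ultimately have ne: "g \<noteq> simple_root i" "g \<noteq> simple_root j" "g \<noteq> simple_root k" .
  let ?r = "cox_refl W s"
  have "?r i g \<in> pos_roots W s" using g(1) ne(1) by (rule cox_refl_pos)
  \<comment> \<open>\<open>s i\<close> fixes \<open>simple_root j\<close>, so equality here would
    force \<open>g\<close> to be \<open>simple_root j\<close>.\<close>
  moreover have "?r i g \<noteq> simple_root j"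
    using ne(2) cox_refl_invol[OF cs, of i g] cox_refl_simple_commuting commuting by metis
  ultimately have "?r j (?r i g) \<in> pos_roots W s" by (rule cox_refl_pos)
  moreover have "?r j (?r i g) \<noteq> simple_root k"
    using ne(3) cox_refl_invol[OF cs] cox_refl_simple_commuting commuting by metis
  ultimately have 1: "?r k (?r j (?r i g)) \<in> pos_roots W s" by (rule cox_refl_pos)
  \<comment> \<open>This element sends \<beta> to \<open>- simple_root l\<close>, so it also makes
    \<open>g\<close> negative. Its final factor \<open>s l\<close> then negates a positive root,
    which can only be \<open>simple_root l\<close>.\<close>
  have v: "act (s l \<otimes>\<^bsub>W\<^esub> (s k \<otimes>\<^bsub>W\<^esub> (s j \<otimes>\<^bsub>W\<^esub> s i))) x = ?r l (?r k (?r j (?r i x)))" for x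
    by (simp add: cox_act_mult[OF cs] cox_act_gen[OF cs])
  have "neg_root W s (act (s l \<otimes>\<^bsub>W\<^esub> (s k \<otimes>\<^bsub>W\<^esub> (s j \<otimes>\<^bsub>W\<^esub> s i))) \<beta>)"
    unfolding v star_root_eq(1)
    by (simp add: cox_refl_invol[OF cs] cox_refl_simple_self[OF cs] neg_root_uminus_pos simple_root_pos)
  from dominatesD[OF g(3) _ this] have "neg_root W s (?r l (?r k (?r j (?r i g))))"
    by (simp add: v)
  then have "?r l (?r k (?r j (?r i g))) \<notin> pos_roots W s"
    using pos_root_iff pos_roots_roots by blast
  then have "?r k (?r j (?r i g)) = simple_root l" using cox_refl_pos[OF 1] by blast
  then have "g = \<beta>" unfolding star_root_eq(1) by (metis cox_refl_invol[OF cs])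
  then show False using g(2) by simp
qed

lemma star_root_form:
  assumes "n \<in> {i, j, k}"
  shows "B \<beta> (simple_root n) = t n / 2"
  using assms distinct
  by (auto simp: \<beta>_def cox_form_linear_left cox_form_simple commuting commuting' cox_m_diag[OF cs]
      cox_m_sym[OF cs, of l] t_def)

lemma star_root_not_super_elementary:
  assumes sq: "4 \<le> (t i)\<^sup>2 + (t j)\<^sup>2" "4 \<le> (t i)\<^sup>2 + (t k)\<^sup>2" "4 \<le> (t j)\<^sup>2 + (t k)\<^sup>2"
  shows "\<not> super_elementary_root W s \<beta>"
proof
  assume "super_elementary_root W s \<beta>"
  then obtain x y where x: "x \<in> carrier W" and y: "y \<in> carrier W"
    and xy: "inversion_set W s x \<inter> inversion_set W s y = {\<beta>}"
    unfolding super_elementary_root_def by blast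
  let ?I = "{i, j, k}"
  \<comment> \<open>These are the \<gamma> roots: dropping the term of \<open>n\<close> amounts to
    omitting the reflection \<open>s n\<close>.\<close>
  define g where "g n = \<beta> - t n *\<^sub>R simple_root n" for n
  have "g i = cox_refl W s j (cox_refl W s k (simple_root l))"
    "g j = cox_refl W s i (cox_refl W s k (simple_root l))"
    "g k = cox_refl W s i (cox_refl W s j (simple_root l))"
    by (simp_all add: g_def \<beta>_def t_def cox_refl_add cox_refl_scale cox_refl_simple commuting commuting')
  then have "g n \<in> roots W s" if "n \<in> ?I" for n
    using that roots_refl simple_root_roots by auto
  then have gpos: "g n \<in> pos_roots W s" if "n \<in> ?I" for n
    using that coeff_pos distinct
    by (auto simp: pos_roots_def g_def \<beta>_def simple_root_nth less_imp_le)
  have gform: "B (g p) (g q) \<le> -1" if "p \<in> ?I" "q \<in> ?I" "p \<noteq> q" for p q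
  proof -
    have "B (simple_root p) (simple_root q) = 0"
      using that by (auto simp: cox_form_simple commuting commuting')
    moreover have "B \<beta> \<beta> = 1" using root_form star_root_pos pos_roots_roots by blast
    \<comment> \<open>By \<open>star_root_form\<close>, each cross term with \<beta> contributes
      minus half a square, so \<open>sq\<close> is exactly the bound -1.\<close>
    ultimately have "B (g p) (g q) = 1 - ((t p)\<^sup>2 + (t q)\<^sup>2) / 2"
      using star_root_form[OF that(1)] star_root_form[OF that(2)]
      by (simp add: g_def cox_form_linear_left cox_form_linear_right
          cox_form_sym[of "simple_root p" \<beta>] power2_eq_square field_simps)
    then show ?thesis using that sq by auto
  qed
  have separate: False
    if "z \<in> carrier W" "\<beta> \<in> inversion_set W s z" "p \<in> ?I" "q \<in> ?I" "p \<noteq> q"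
      "simple_root p \<notin> inversion_set W s z" "simple_root q \<notin> inversion_set W s z" for z p q
  proof -
    have "g n \<in> inversion_set W s z" if "n \<in> {p, q}" for n
    proof (rule inversion_set_summand[of z _ "simple_root n" "t n"])
      show "0 \<le> t n" using coeff_pos[of n] \<open>n \<in> {p, q}\<close> \<open>p \<in> ?I\<close> \<open>q \<in> ?I\<close> by auto
    qed (use \<open>n \<in> {p, q}\<close> \<open>p \<in> ?I\<close> \<open>q \<in> ?I\<close> \<open>z \<in> carrier W\<close> \<open>\<beta> \<in> inversion_set W s z\<close>
        \<open>simple_root p \<notin> _\<close> \<open>simple_root q \<notin> _\<close> gpos simple_root_pos in \<open>auto simp: g_def\<close>)
    then have "g p \<in> inversion_set W s z" "g q \<in> inversion_set W s z" by auto
    from inversion_set_form_gt[OF \<open>z \<in> carrier W\<close> this] gform[OF \<open>p \<in> ?I\<close> \<open>q \<in> ?I\<close> \<open>p \<noteq> q\<close>]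
    show False by simp
  qed
  have "simple_root n \<noteq> \<beta>" if "n \<in> ?I" for n
  proof
    assume "simple_root n = \<beta>"
    then have "simple_root n $ l = \<beta> $ l" by simp
    then show False using that distinct by (auto simp: \<beta>_def simple_root_nth)
  qed
  then have "simple_root n \<notin> inversion_set W s x \<or> simple_root n \<notin> inversion_set W s y"
    if "n \<in> ?I" for n
    using that xy by blast
  then have "simple_root i \<notin> inversion_set W s x \<or> simple_root i \<notin> inversion_set W s y"
    "simple_root j \<notin> inversion_set W s x \<or> simple_root j \<notin> inversion_set W s y"
    "simple_root k \<notin> inversion_set W s x \<or> simple_root k \<notin> inversion_set W s y"
    by blast+
  \<comment> \<open>Pigeonhole: each of three simple roots is missing from one of two sets, but
    neither set may miss two of them.\<close>
  moreover have "\<not> (simple_root i \<notin> inversion_set W s z \<and> simple_root j \<notin> inversion_set W s z)"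
    "\<not> (simple_root i \<notin> inversion_set W s z \<and> simple_root k \<notin> inversion_set W s z)"
    "\<not> (simple_root j \<notin> inversion_set W s z \<and> simple_root k \<notin> inversion_set W s z)"
    if "z \<in> {x, y}" for z
  proof -
    have "z \<in> carrier W" "\<beta> \<in> inversion_set W s z" using that x y xy by auto
    note sep = separate[OF this]
    show "\<not> (simple_root i \<notin> inversion_set W s z \<and> simple_root j \<notin> inversion_set W s z)"
      "\<not> (simple_root i \<notin> inversion_set W s z \<and> simple_root k \<notin> inversion_set W s z)"
      "\<not> (simple_root j \<notin> inversion_set W s z \<and> simple_root k \<notin> inversion_set W s z)"
      using sep[of i j] sep[of i k] sep[of j k] distinct by auto
  qed
  ultimately show False by blast
qed

end

end

text \<open>Doubling the angles reduces the claim to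
  \<open>cos (2 * a) + cos (2 * b) \<ge> 0\<close>, and the hypothesis says
  \<open>2 * a \<le> pi - 2 * b\<close>.\<close>

lemma four_le_sum_cos_squares:
  assumes "1 / real m + 1 / real n \<le> 1 / 2" "m \<noteq> 0" "n \<noteq> 0"
  shows "4 \<le> (2 * cos (pi / real m))\<^sup>2 + (2 * cos (pi / real n))\<^sup>2"
proof -
  define a where "a = pi / real m"
  define b where "b = pi / real n"
  have "pi * (1 / real m + 1 / real n) \<le> pi * (1 / 2)" using assms(1) by (intro mult_left_mono) auto
  then have "2 * a \<le> pi - 2 * b" by (simp add: a_def b_def algebra_simps)
  moreover have "0 \<le> a" "0 \<le> b" by (simp_all add: a_def b_def)
  ultimately have "cos (pi - 2 * b) \<le> cos (2 * a)" by (intro cos_monotone_0_pi_le) auto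
  then have "0 \<le> cos (2 * a) + cos (2 * b)" by simp
  then show ?thesis unfolding a_def[symmetric] b_def[symmetric]
    by (simp add: cos_double_cos power_mult_distrib)
qed

text \<open>\<open>1 / real n > 0\<close> makes the bound on \<open>1 / real m\<close> strict; at
  \<open>n = 0\<close> this term would be 0 and only \<open>m \<ge> 2\<close> would follow.\<close>

lemma three_le_of_inverse_sum:
  assumes "1 / real m + 1 / real n \<le> 1 / 2" "m \<noteq> 0" "n \<noteq> 0"
  shows "3 \<le> m"
proof -
  have "1 / real n > 0" using assms(3) by simp
  then have "1 / real m < 1 / 2" using assms(1) by linarith
  then show ?thesis using assms(2) by (simp add: field_simps)
qed

theorem theorem7p8:
  fixes W :: "('g, 'b) monoid_scheme" and s :: "4 \<Rightarrow> 'g"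
    and m1 m2 m3 :: nat and t1 t2 t3 :: real and \<beta> :: "real ^ 4"
  assumes "coxeter_system W s"
    and "cox_m W s 1 2 = 2" and "cox_m W s 1 3 = 2" and "cox_m W s 2 3 = 2"
    and "cox_m W s 1 4 = m1" and "cox_m W s 2 4 = m2" and "cox_m W s 3 4 = m3"
    and "m1 \<noteq> 0" and "m2 \<noteq> 0" and "m3 \<noteq> 0"
    and "1 / real m1 + 1 / real m2 \<le> 1 / 2"
    and "1 / real m1 + 1 / real m3 \<le> 1 / 2"
    and "1 / real m2 + 1 / real m3 \<le> 1 / 2"
    and "t1 = 2 * cos (pi / real m1)"
    and "t2 = 2 * cos (pi / real m2)"
    and "t3 = 2 * cos (pi / real m3)"
    and "\<beta> = t1 *\<^sub>R simple_root 1 + t2 *\<^sub>R simple_root 2 + t3 *\<^sub>R simple_root 3 + simple_root 4"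
  shows "elementary_root W s \<beta> \<and> \<not> super_elementary_root W s \<beta>"
proof -
  have m: "3 \<le> m1" "3 \<le> m2" "3 \<le> m3"
    using three_le_of_inverse_sum[of m1 m2] three_le_of_inverse_sum[of m2 m3]
      three_le_of_inverse_sum[of m3 m1] assms(8-13) by simp_all
  have large: "3 \<le> cox_m W s n 4" if "n \<in> {1, 2, 3}" for n using that m assms(5-7) by auto
  \<comment> \<open>Numerals of type \<open>4\<close> are read modulo 4, so the last index is
    \<open>0\<close>; the four remain distinct.\<close>
  have "distinct [1, 2, 3, 4 :: 4]" by simp
  note star = star_root_elementary[OF assms(1) this assms(2-4) large]
    star_root_not_super_elementary[OF assms(1) this assms(2-4) large]
  show ?thesis
    using star four_le_sum_cos_squares assms(8-13)
    unfolding assms(5-7,14-17) by blast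
qed

end
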